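(* For every integer $k\ge1$, the set $D$ (OEIS A036991) contains an arithmetic progression of length $k$: there exist integers $a\ge0$ and $d>0$ such that $a, a+d, a+2d,\dots,a+(k-1)d$ all belong to $D$.
   Context: $D$ (OEIS A036991, the "Dyck numbers") is the set consisting of $0$ together with all positive integers $n$ whose binary representation (without leading zeros) has the property that every suffix contains at least as many digits $1$ as digits $0$. *)

theory Defs
  imports "HOL-Library.Sublist"
begin

text \<open>Most significant digit first, without leading zeros; the list for 0 is empty.\<close>

fun binary_digits :: "nat \<Rightarrow> nat list" where
  "binary_digits n = (if n = 0 then [] else binary_digits (n div 2) @ [n mod 2])"

declare binary_digits.simps [simp del]

definition dyck_numbers :: "nat set" where
  "dyck_numbers = {0} \<union>
    {n. n > 0 \<and> (\<forall>s. suffix s (binary_digits n) \<longrightarrow> count_list s 1 \<ge> count_list s 0)}"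

end

theory Submission
  imports Defs
begin

text \<open>
  Appending \<open>m\<close> ones to the binary expansion of \<open>i\<close> gives \<open>(2 ^ m - 1) + i * 2 ^ m\<close>, which is an
  arithmetic progression in \<open>i\<close>. Once \<open>m\<close> is at least the number of digits of \<open>i\<close>, the trailing
  ones outweigh every zero of \<open>i\<close>; hence \<open>m = k\<close> works for all \<open>i < k\<close>.
\<close>

lemma binary_digits_double_plus_one:
  "binary_digits (2 * n + 1) = binary_digits n @ [1]"
  by (subst binary_digits.simps) simp

text \<open>Each further trailing one is the map \<open>n\<close> to \<open>2 * n + 1\<close>, which
  sends the value for \<open>m\<close> to the value for \<open>Suc m\<close>.\<close>

lemma binary_digits_append_ones:
  "binary_digits ((2 ^ m - 1) + i * 2 ^ m) = binary_digits i @ replicate m 1"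
proof (induction m)
  case 0
  show ?case by simp
next
  case (Suc m)
  \<comment> \<open>Naming the predecessor of \<open>2 ^ m\<close> eliminates truncated
    subtraction.\<close>
  obtain c where "(2::nat) ^ m = Suc c"
    by (metis not0_implies_Suc power_not_zero zero_neq_numeral)
  then have "(2 ^ Suc m - 1) + i * 2 ^ Suc m = 2 * ((2 ^ m - 1) + i * 2 ^ m) + (1::nat)"
    by simp
  then show ?case
    using Suc.IH by (simp only: binary_digits_double_plus_one) (simp add: replicate_append_same)
qed

text \<open>This crude bound suffices to let the single exponent \<open>k\<close> serve every
  \<open>i < k\<close>.\<close>

lemma length_binary_digits_le: "length (binary_digits n) \<le> n"
proof (induction n rule: less_induct)
  case (less n)
  show ?case
  proof (cases "n = 0")
    case True
    then show ?thesis by (simp add: binary_digits.simps)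
  next
    case False
    then have "length (binary_digits n) = Suc (length (binary_digits (n div 2)))"
      by (subst binary_digits.simps) simp
    also have "\<dots> \<le> Suc (n div 2)"
      using less.IH[of "n div 2"] False by simp
    also have "\<dots> \<le> n"
      using False by linarith
    finally show ?thesis .
  qed
qed

lemma count_list_replicate: "count_list (replicate n x) y = (if x = y then n else 0)"
  by (induction n) auto

text \<open>A suffix either lies inside the block of ones, so has no zeros, or contains the whole
  block, whose \<open>m\<close> ones cover the at most \<open>m\<close> zeros coming from
  \<open>i\<close>.\<close>

lemma append_ones_in_dyck_numbers:
  assumes "length (binary_digits i) \<le> m"
  shows "(2 ^ m - 1) + i * 2 ^ m \<in> dyck_numbers"
proof -
  have "count_list s 0 \<le> count_list s 1"
    if "suffix s (binary_digits i @ replicate m 1)" for s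
    using that unfolding suffix_append
  proof (elim disjE exE conjE)
    assume "suffix s (replicate m 1)"
    then have "set s \<subseteq> {1}"
      using set_mono_suffix by fastforce
    then show ?thesis
      by (metis count_notin le0 singletonD subsetD zero_neq_one)
  next
    fix t
    assume s: "s = t @ replicate m 1" and t: "suffix t (binary_digits i)"
    have "count_list s 0 = count_list t 0"
      by (simp add: s count_list_replicate)
    also have "\<dots> \<le> length t"
      by (rule count_le_length)
    also have "\<dots> \<le> m"
      using suffix_length_le[OF t] assms by simp
    also have "\<dots> \<le> count_list s 1"
      by (simp add: s count_list_replicate)
    finally show ?thesis .
  qed
  then show ?thesis
    \<comment> \<open>The value is 0 exactly when \<open>m\<close> and \<open>i\<close> are both 0;
      that case falls under the separate \<open>{0}\<close>.\<close>
    unfolding dyck_numbers_def using binary_digits_append_ones[of m i] by auto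
qed

theorem theorem7:
  fixes k :: nat
  assumes "k \<ge> 1"
  shows "\<exists>a d :: nat. d > 0 \<and> (\<forall>i<k. a + i * d \<in> dyck_numbers)"
proof (intro exI conjI allI impI)
  show "(2::nat) ^ k > 0" by simp
next
  fix i assume "i < k"
  then show "(2 ^ k - 1) + i * 2 ^ k \<in> dyck_numbers"
    using length_binary_digits_le[of i] by (intro append_ones_in_dyck_numbers) simp
qed

end
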